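(* Let $f(w,z)$ be an $L$-smooth convex loss function in $w$ for each $z\in\mathcal{Z}$ and assume that the stochastic gradient $\nabla_w f(w,z)$ has $\sigma^2$-bounded variance for all $w\in W$, where $W\subseteq\mathbb{R}^n$ is a closed convex set. Suppose the update rule $\phi$ used in the serial setting has an expected optimality gap bounded by $$\bar\psi(\sigma^2,m)=\frac{2D^2L}{m}+\frac{2D\sigma}{\sqrt m}.$$ If the batch size in the DMB (distributed mini-batch) algorithm for stochastic optimization is chosen as $b(m)=\Theta(m^\rho)$, where $\rho\in(0,1/2)$, then $$\lim_{\epsilon\to0}S(\epsilon)=k,$$ where $k$ is the number of parallel computing nodes and $S(\epsilon)$ is the parallel speed-up with respect to the expected optimality gap $\epsilon$, as defined in the context.
   Context: **Problem.** Minimize $F(w)=\mathbb E_z[f(w,z)]$ over $w\in W$, given i.i.d. samples $z_1,z_2,\dots$ from a fixed unknown distribution on $\mathcal Z$; a minimizer $w^\star$ is assumed to exist. $\|\cdot\|$ is the Euclidean norm. $L$-smooth means $\|\nabla_w f(w,z)-\nabla_w f(w',z)\|\le L\|w-w'\|$ for all $z\in\mathcal Z$ and $w,w'\in W$. $\sigma^2$-bounded variance (with a constant $\sigma\ge0$) means $\mathbb E_z\|\nabla_w f(w,z)-\nabla F(w)\|^2\le\sigma^2$ for all $w\in W$. $D$ is a constant appearing in the assumed bound $\bar\psi$. **Serial algorithm.** An update rule $\phi$ produces $(w_{j+1},a_{j+1})=\phi(a_j,g_j,\alpha_j)$ from a state vector $a_j$, the stochastic gradient $g_j=\nabla_w f(w_j,z_j)$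 and an iteration-dependent parameter $\alpha_j$. The output after $m$ samples is $\bar w_m=\frac1m\sum_{j=1}^m w_j$; the expected optimality gap is $\mathbb E[F(\bar w_m)-F(w^\star)]$, and $\bar\psi(\sigma^2,m)$ is an upper bound on it. **DMB algorithm for stochastic optimization.** $k$ nodes process $m$ samples in $m/b$ batches of size $b$. In batch $j$ each node computes the stochastic gradients at $w_j$ of $b/k$ samples; the average $\bar g_j$ of all $b$ gradients is obtained through a distributed vector-sum operation over the network, and then $(w_{j+1},a_{j+1})=\phi(a_j,\bar g_j,\alpha_j)$. The output is the average of the predictors $w_j$ over the batches. Its expected optimality gap after $m$ samples is bounded by $\bar\psi(\sigma^2/b,m/b)=\frac{2bD^2L}{m}+\frac{2D\sigma}{\sqrt m}$. A time-unit is the time a single node takes to process one sample, and $\delta$ is the latency of the vector-sum operation measured in time-units, so that one batch takes $b/k+\delta$ time-units. **Speed-up.** For a target expected optimality gap $\epsilon$, let $m_{\mathrm{srl}}(\epsilon)$ be the number of samples the serial algorithm needs to reach the target, given by solving $\bar\psi(\sigma^2,m)=\epsilon$ for $m$, and let $m_{\mathrm{DMB}}(\epsilon)$ be the number of samples needed by the DMB algorithm, given by substituting $b=b(m)$ into $\bar\psi(\sigma^2/b,m/b)=\epsilon$ and solving for $m$. With $b=b(m_{\mathrm{DMB}}(\epsilon))$, define $$S(\epsilon)=\frac{m_{\mathrm{srl}}(\epsilon)}{\frac{m_{\mathrm{DMB}}(\epsilon)}{b}\left(\frac bk+\delta\right)} .$$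
   Formalization: The constants σ and D are taken to be strictly positive: for σ = 0 (and L, D > 0) the speed-up equals 1/(b/k+δ) and tends to 0 rather than k, and for D = 0 the equations defining the sample counts have no solution. *)

theory Defs
  imports "HOL-Probability.Probability" "HOL-Library.Landau_Symbols"
begin

text \<open>\<open>g\<close> is a gradient of \<open>h\<close> on \<open>W\<close>. The derivative is taken relative to \<open>W\<close>, so that \<open>h\<close>
  only matters on \<open>W\<close>; at interior points of \<open>W\<close> this is the usual gradient.\<close>

definition gradient_on ::
    "(real^'n) set \<Rightarrow> (real^'n \<Rightarrow> real) \<Rightarrow> (real^'n \<Rightarrow> real^'n) \<Rightarrow> bool" where
  "gradient_on W h g \<longleftrightarrow> (\<forall>w\<in>W. (h has_derivative (\<lambda>v. g w \<bullet> v)) (at w within W))"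

definition risk :: "'z measure \<Rightarrow> (real^'n \<Rightarrow> 'z \<Rightarrow> real) \<Rightarrow> real^'n \<Rightarrow> real" where
  "risk P f w = (\<integral>z. f w z \<partial>P)"

definition bounded_variance ::
    "(real^'n) set \<Rightarrow> 'z measure \<Rightarrow> (real^'n \<Rightarrow> 'z \<Rightarrow> real^'n) \<Rightarrow> (real^'n \<Rightarrow> real^'n) \<Rightarrow> real \<Rightarrow> bool"
  where
  "bounded_variance W P g G v \<longleftrightarrow>
     (\<forall>w\<in>W. integrable P (\<lambda>z. (norm (g w z - G w))\<^sup>2) \<and>
             (\<integral>z. (norm (g w z - G w))\<^sup>2 \<partial>P) \<le> v)"

definition iid_samples :: "'\<omega> measure \<Rightarrow> 'z measure \<Rightarrow> (nat \<Rightarrow> '\<omega> \<Rightarrow> 'z) \<Rightarrow> bool" where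
  "iid_samples M P Z \<longleftrightarrow>
     prob_space.indep_vars M (\<lambda>_. P) Z UNIV \<and> (\<forall>i. distr M P (Z i) = P)"

text \<open>The serial algorithm with update rule \<open>\<phi>\<close>, parameters \<open>\<alpha>\<close>, stochastic gradient \<open>g\<close>, start
  \<open>(w1, a1)\<close> and sample sequence \<open>z\<close>. Indices are shifted by one: step \<open>j\<close> yields the pair
  \<open>(w\<^sub>j\<^sub>+\<^sub>1, a\<^sub>j\<^sub>+\<^sub>1)\<close> of the 1-based numbering, and \<open>z j\<close> is the sample numbered \<open>j + 1\<close>.\<close>

primrec serial_run ::
    "('a \<Rightarrow> real^'n \<Rightarrow> 'p \<Rightarrow> (real^'n) \<times> 'a) \<Rightarrow> (nat \<Rightarrow> 'p) \<Rightarrow> (real^'n \<Rightarrow> 'z \<Rightarrow> real^'n) \<Rightarrow>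
     real^'n \<Rightarrow> 'a \<Rightarrow> (nat \<Rightarrow> 'z) \<Rightarrow> nat \<Rightarrow> (real^'n) \<times> 'a" where
  "serial_run \<phi> \<alpha> g w1 a1 z 0 = (w1, a1)"
| "serial_run \<phi> \<alpha> g w1 a1 z (Suc j) =
     (case serial_run \<phi> \<alpha> g w1 a1 z j of (w, a) \<Rightarrow> \<phi> a (g w (z j)) (\<alpha> j))"

definition serial_output ::
    "('a \<Rightarrow> real^'n \<Rightarrow> 'p \<Rightarrow> (real^'n) \<times> 'a) \<Rightarrow> (nat \<Rightarrow> 'p) \<Rightarrow> (real^'n \<Rightarrow> 'z \<Rightarrow> real^'n) \<Rightarrow>
     real^'n \<Rightarrow> 'a \<Rightarrow> (nat \<Rightarrow> 'z) \<Rightarrow> nat \<Rightarrow> real^'n" where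
  "serial_output \<phi> \<alpha> g w1 a1 z m =
     (1 / real m) *\<^sub>R (\<Sum>j<m. fst (serial_run \<phi> \<alpha> g w1 a1 z j))"

text \<open>Integrability is part of the bound, since a divergent Bochner integral is \<open>0\<close> by convention.\<close>

definition expected_gap_bounded ::
    "'\<omega> measure \<Rightarrow> (real^'n \<Rightarrow> real) \<Rightarrow> real^'n \<Rightarrow> (nat \<Rightarrow> '\<omega> \<Rightarrow> real^'n) \<Rightarrow> (nat \<Rightarrow> real) \<Rightarrow> bool"
  where
  "expected_gap_bounded M F wstar out bnd \<longleftrightarrow>
     (\<forall>m\<ge>1. integrable M (\<lambda>x. F (out m x) - F wstar) \<and>
             (\<integral>x. F (out m x) - F wstar \<partial>M) \<le> bnd m)"

text \<open>The first varying argument \<open>v\<close> is the variance \<open>\<sigma>\<^sup>2\<close>, not the standard deviation.\<close>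

definition gap_bound :: "real \<Rightarrow> real \<Rightarrow> real \<Rightarrow> real \<Rightarrow> real" where
  "gap_bound D L v m = 2 * D\<^sup>2 * L / m + 2 * D * sqrt v / sqrt m"

text \<open>\<open>N \<epsilon>\<close> is a positive solution \<open>m\<close> of \<open>\<psi> m = \<epsilon>\<close>, for all small targets \<open>\<epsilon> > 0\<close>. Sample
  counts are real numbers here.\<close>

definition solves_for_samples :: "(real \<Rightarrow> real) \<Rightarrow> (real \<Rightarrow> real) \<Rightarrow> bool" where
  "solves_for_samples \<psi> N \<longleftrightarrow> (\<forall>\<^sub>F \<epsilon> in at_right 0. 0 < N \<epsilon> \<and> \<psi> (N \<epsilon>) = \<epsilon>)"

definition serial_sample_count :: "real \<Rightarrow> real \<Rightarrow> real \<Rightarrow> (real \<Rightarrow> real) \<Rightarrow> bool" where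
  "serial_sample_count D L \<sigma> N \<longleftrightarrow> solves_for_samples (\<lambda>m. gap_bound D L (\<sigma>\<^sup>2) m) N"

definition dmb_sample_count ::
    "real \<Rightarrow> real \<Rightarrow> real \<Rightarrow> (real \<Rightarrow> real) \<Rightarrow> (real \<Rightarrow> real) \<Rightarrow> bool" where
  "dmb_sample_count D L \<sigma> b N \<longleftrightarrow>
     solves_for_samples (\<lambda>m. gap_bound D L (\<sigma>\<^sup>2 / b m) (m / b m)) N"

text \<open>Time-units for \<open>m\<close> samples on \<open>k\<close> nodes: \<open>m / B\<close> batches of size \<open>B\<close>, each node processing
  \<open>B / k\<close> samples per batch, followed by a vector-sum of latency \<open>\<delta>\<close>.\<close>

definition dmb_time :: "nat \<Rightarrow> real \<Rightarrow> real \<Rightarrow> real \<Rightarrow> real" where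
  "dmb_time k \<delta> B m = m / B * (B / real k + \<delta>)"

definition speedup ::
    "nat \<Rightarrow> real \<Rightarrow> (real \<Rightarrow> real) \<Rightarrow> (real \<Rightarrow> real) \<Rightarrow> (real \<Rightarrow> real) \<Rightarrow> real \<Rightarrow> real" where
  "speedup k \<delta> b m_srl m_dmb \<epsilon> = m_srl \<epsilon> / dmb_time k \<delta> (b (m_dmb \<epsilon>)) (m_dmb \<epsilon>)"

end

theory Submission
  imports Defs "HOL-Real_Asymp.Real_Asymp"
begin

text \<open>If \<open>m\<close> samples in batches of size \<open>B m = o(\<surd>m)\<close> have gap bound \<open>\<epsilon>\<close>, then
  \<open>\<epsilon> \<surd>m = 2 D \<sigma> + 2 D\<^sup>2 L B m / \<surd>m\<close>, so \<open>\<epsilon> \<surd>m\<close> tends to \<open>2 D \<sigma>\<close> as \<open>\<epsilon>\<close> tends to \<open>0\<close>. This holds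
  both for the serial algorithm (\<open>B = 1\<close>) and for DMB (\<open>B m = \<Theta>(m\<^sup>\<rho>)\<close> with \<open>\<rho> < 1/2\<close>), hence the
  ratio of the two sample counts tends to \<open>1\<close>. The latency is negligible because \<open>B m\<close> tends to
  infinity.\<close>

text \<open>Averaging \<open>B\<close> gradients divides both the variance and the number of steps
  by \<open>B\<close>. The two effects cancel in the stochastic term, so only the smoothness term
  pays for batching.\<close>

lemma gap_bound_minibatch:
  assumes "0 < m" "0 < B" "0 \<le> \<sigma>"
  shows "gap_bound D L (\<sigma>\<^sup>2 / B) (m / B) = 2 * D\<^sup>2 * L * B / m + 2 * D * \<sigma> / sqrt m"
  using assms by (simp add: gap_bound_def real_sqrt_divide)

text \<open>\<open>N\<close> is an arbitrary solution of the equation for the sample count, so its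
  divergence has to be read off that equation. The divergence then turns \<open>B_small\<close>, a
  limit in the sample count, into a limit in \<epsilon>.\<close>

lemma minibatch_sample_count:
  fixes B N :: "real \<Rightarrow> real"
  assumes params: "0 < D" "0 \<le> L" "0 < \<sigma>"
    and B_pos: "\<And>m. 0 < m \<Longrightarrow> 0 < B m"
    and B_small: "((\<lambda>m. B m / sqrt m) \<longlongrightarrow> 0) at_top"
    and N: "dmb_sample_count D L \<sigma> B N"
  shows minibatch_sample_count_at_top: "filterlim N at_top (at_right 0)"
    and minibatch_sample_count_asymp: "((\<lambda>\<epsilon>. \<epsilon> * sqrt (N \<epsilon>)) \<longlongrightarrow> 2 * D * \<sigma>) (at_right 0)"
proof -
  have sol: "\<forall>\<^sub>F \<epsilon> in at_right 0. 0 < \<epsilon> \<and> 0 < N \<epsilon> \<and>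
      2 * D\<^sup>2 * L * B (N \<epsilon>) / N \<epsilon> + 2 * D * \<sigma> / sqrt (N \<epsilon>) = \<epsilon>"
    using N[unfolded dmb_sample_count_def solves_for_samples_def] eventually_at_right_less[of 0]
  proof eventually_elim
    case (elim \<epsilon>)
    then show ?case using params B_pos[of "N \<epsilon>"]
        gap_bound_minibatch[of "N \<epsilon>" "B (N \<epsilon>)" \<sigma> D L] by simp
  qed
  \<comment> \<open>This lower bound for \<open>N \<epsilon>\<close> comes from dropping the
    nonnegative smoothness term, which leaves
    \<open>2 * D * \<sigma> / sqrt (N \<epsilon>) \<le> \<epsilon>\<close>.\<close>
  have "filterlim (\<lambda>\<epsilon>::real. (2 * D * \<sigma> / \<epsilon>)\<^sup>2) at_top (at_right 0)"
    using params by real_asymp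
  moreover have "\<forall>\<^sub>F \<epsilon> in at_right 0. (2 * D * \<sigma> / \<epsilon>)\<^sup>2 \<le> N \<epsilon>"
    using sol
  proof eventually_elim
    case (elim \<epsilon>)
    have "0 \<le> 2 * D\<^sup>2 * L * B (N \<epsilon>) / N \<epsilon>"
      using elim params B_pos[of "N \<epsilon>"] by simp
    then have "2 * D * \<sigma> / sqrt (N \<epsilon>) \<le> \<epsilon>" using elim by linarith
    then have "2 * D * \<sigma> / \<epsilon> \<le> sqrt (N \<epsilon>)"
      using elim by (simp add: field_simps)
    then have "(2 * D * \<sigma> / \<epsilon>)\<^sup>2 \<le> (sqrt (N \<epsilon>))\<^sup>2"
      using elim params by (intro power_mono) auto
    then show ?case using elim by simp
  qed
  ultimately show top: "filterlim N at_top (at_right 0)"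
    by (rule filterlim_at_top_mono)
  have "((\<lambda>\<epsilon>. 2 * D * \<sigma> + 2 * D\<^sup>2 * L * (B (N \<epsilon>) / sqrt (N \<epsilon>)))
      \<longlongrightarrow> 2 * D * \<sigma> + 2 * D\<^sup>2 * L * 0) (at_right 0)"
    by (intro tendsto_intros filterlim_compose[OF B_small top])
  moreover have "\<forall>\<^sub>F \<epsilon> in at_right 0.
      2 * D * \<sigma> + 2 * D\<^sup>2 * L * (B (N \<epsilon>) / sqrt (N \<epsilon>)) = \<epsilon> * sqrt (N \<epsilon>)"
    using sol
  proof eventually_elim
    case (elim \<epsilon>)
    then have "0 < sqrt (N \<epsilon>)" "N \<epsilon> = sqrt (N \<epsilon>) * sqrt (N \<epsilon>)" by simp_all
    then have "(2 * D\<^sup>2 * L * B (N \<epsilon>) / N \<epsilon> + 2 * D * \<sigma> / sqrt (N \<epsilon>)) * sqrt (N \<epsilon>)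
        = 2 * D * \<sigma> + 2 * D\<^sup>2 * L * (B (N \<epsilon>) / sqrt (N \<epsilon>))"
      by (simp add: distrib_right real_div_sqrt field_simps)
    then show ?case using elim by simp
  qed
  ultimately show "((\<lambda>\<epsilon>. \<epsilon> * sqrt (N \<epsilon>)) \<longlongrightarrow> 2 * D * \<sigma>) (at_right 0)"
    by (simp add: tendsto_cong)
qed

text \<open>Both sample counts give the same limit \<open>2 * D * \<sigma>\<close>, which is nonzero
  since \<open>D\<close> and \<open>\<sigma>\<close> are positive, so the quotient tends to
  1.\<close>

lemma speedup_tendsto:
  fixes b m_srl m_dmb :: "real \<Rightarrow> real"
  assumes params: "0 < D" "0 \<le> L" "0 < \<sigma>" "1 \<le> k"
    and rho: "0 < \<rho>" "\<rho> < 1 / 2"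
    and b_pos: "\<And>m. 0 < m \<Longrightarrow> 0 < b m"
    and b_theta: "b \<in> \<Theta>(\<lambda>m. m powr \<rho>)"
    and m_srl: "serial_sample_count D L \<sigma> m_srl"
    and m_dmb: "dmb_sample_count D L \<sigma> b m_dmb"
  shows "(speedup k \<delta> b m_srl m_dmb \<longlongrightarrow> real k) (at_right 0)"
proof -
  \<comment> \<open>Here \<open>\<rho> < 1 / 2\<close> enters: it keeps the smoothness term below
    the stochastic one.\<close>
  have "(\<lambda>m::real. m powr \<rho>) \<in> o(\<lambda>m. sqrt m)" using rho by real_asymp
  then have "b \<in> o(\<lambda>m. sqrt m)"
    using b_theta landau_o.big_small_trans by blast
  then have b_small: "((\<lambda>m. b m / sqrt m) \<longlongrightarrow> 0) at_top"
    by (rule smalloD_tendsto)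
  \<comment> \<open>Here \<open>0 < \<rho>\<close> enters: growing batches spread the latency over
    ever more samples.\<close>
  have "(\<lambda>_::real. 1::real) \<in> o(\<lambda>m. m powr \<rho>)" using rho by real_asymp
  then have "(\<lambda>_. 1) \<in> o(b)"
    using b_theta landau_o.small.cong_bigtheta by blast
  then have b_inv: "((\<lambda>m. 1 / b m) \<longlongrightarrow> 0) at_top"
    by (rule smalloD_tendsto)
  have one_small: "((\<lambda>m::real. 1 / sqrt m) \<longlongrightarrow> 0) at_top" by real_asymp
  \<comment> \<open>The serial equation is the DMB equation with constant batch size 1.\<close>
  have srl: "dmb_sample_count D L \<sigma> (\<lambda>_. 1) m_srl"
    using m_srl by (simp add: dmb_sample_count_def serial_sample_count_def)
  note srl_lim = minibatch_sample_count_asymp[OF params(1-3) _ one_small srl, simplified]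
  note dmb_lim = minibatch_sample_count_asymp[OF params(1-3) b_pos b_small m_dmb]
  note dmb_top = minibatch_sample_count_at_top[OF params(1-3) b_pos b_small m_dmb]
  \<comment> \<open>The factor \<epsilon>, which cancels, gives numerator and denominator finite
    limits of their own; the square restores the ratio of sample counts. The divisor is the DMB time
    per sample.\<close>
  have "((\<lambda>\<epsilon>. (\<epsilon> * sqrt (m_srl \<epsilon>) / (\<epsilon> * sqrt (m_dmb \<epsilon>)))\<^sup>2 / (1 / k + \<delta> * (1 / b (m_dmb \<epsilon>))))
      \<longlongrightarrow> (2 * D * \<sigma> / (2 * D * \<sigma>))\<^sup>2 / (1 / k + \<delta> * 0)) (at_right 0)"
    using params
    by (intro tendsto_intros srl_lim dmb_lim filterlim_compose[OF b_inv dmb_top]) auto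
  moreover have "\<forall>\<^sub>F \<epsilon> in at_right 0.
      (\<epsilon> * sqrt (m_srl \<epsilon>) / (\<epsilon> * sqrt (m_dmb \<epsilon>)))\<^sup>2 / (1 / k + \<delta> * (1 / b (m_dmb \<epsilon>)))
      = speedup k \<delta> b m_srl m_dmb \<epsilon>"
    using m_srl[unfolded serial_sample_count_def solves_for_samples_def]
      m_dmb[unfolded dmb_sample_count_def solves_for_samples_def] eventually_at_right_less[of 0]
  proof eventually_elim
    case (elim \<epsilon>)
    then have "dmb_time k \<delta> (b (m_dmb \<epsilon>)) (m_dmb \<epsilon>)
        = m_dmb \<epsilon> * (1 / k + \<delta> * (1 / b (m_dmb \<epsilon>)))"
      using b_pos[of "m_dmb \<epsilon>"] by (simp add: dmb_time_def field_simps)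
    moreover have "(\<epsilon> * sqrt (m_srl \<epsilon>) / (\<epsilon> * sqrt (m_dmb \<epsilon>)))\<^sup>2 = m_srl \<epsilon> / m_dmb \<epsilon>"
      using elim by (simp add: power_divide)
    ultimately show ?case by (simp add: speedup_def)
  qed
  ultimately show ?thesis
    using params by (simp add: tendsto_cong)
qed

theorem theorem6:
  fixes W :: "(real^'n) set"
    and P :: "'z measure" and M :: "'\<omega> measure" and Z :: "nat \<Rightarrow> '\<omega> \<Rightarrow> 'z"
    and f :: "real^'n \<Rightarrow> 'z \<Rightarrow> real"
    and g :: "real^'n \<Rightarrow> 'z \<Rightarrow> real^'n" and G :: "real^'n \<Rightarrow> real^'n"
    and wstar w1 :: "real^'n"
    and \<phi> :: "'a \<Rightarrow> real^'n \<Rightarrow> 'p \<Rightarrow> (real^'n) \<times> 'a" and \<alpha> :: "nat \<Rightarrow> 'p" and a1 :: 'a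
    and L D \<sigma> \<delta> \<rho> :: real and k :: nat
    and b m_srl m_dmb :: "real \<Rightarrow> real"
  assumes W: "closed W" "convex W"
    and prob: "prob_space P" "prob_space M"
    and samples: "iid_samples M P Z"
    and f_int: "\<And>w. w \<in> W \<Longrightarrow> integrable P (f w)"
    and wstar: "is_arg_min (risk P f) (\<lambda>w. w \<in> W) wstar"
    and f_convex: "\<And>z. z \<in> space P \<Longrightarrow> convex_on W (\<lambda>w. f w z)"
    and f_grad: "\<And>z. z \<in> space P \<Longrightarrow> gradient_on W (\<lambda>w. f w z) (\<lambda>w. g w z)"
    and f_smooth: "\<And>z. z \<in> space P \<Longrightarrow> L-lipschitz_on W (\<lambda>w. g w z)"
    and F_grad: "gradient_on W (risk P f) G"
    and variance: "bounded_variance W P g G (\<sigma>\<^sup>2)"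
    and start: "w1 \<in> W"
    and update: "\<And>a v p. fst (\<phi> a v p) \<in> W"
    and serial_gap: "expected_gap_bounded M (risk P f) wstar
          (\<lambda>m x. serial_output \<phi> \<alpha> g w1 a1 (\<lambda>i. Z i x) m)
          (\<lambda>m. gap_bound D L (\<sigma>\<^sup>2) (real m))"
    and params: "0 < D" "0 < \<sigma>" "0 \<le> \<delta>" "1 \<le> k"
    and rho: "0 < \<rho>" "\<rho> < 1 / 2"
    and b_pos: "\<And>m. 0 < m \<Longrightarrow> 0 < b m"
    and b_theta: "b \<in> \<Theta>(\<lambda>m. m powr \<rho>)"
    and m_srl: "serial_sample_count D L \<sigma> m_srl"
    and m_dmb: "dmb_sample_count D L \<sigma> b m_dmb"
  shows "(speedup k \<delta> b m_srl m_dmb \<longlongrightarrow> real k) (at_right 0)"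
proof -
  \<comment> \<open>A Lipschitz constant is nonnegative by definition, but \<open>f_smooth\<close>
    yields one only at a point of \<open>space P\<close>, which is nonempty for a probability
    space.\<close>
  obtain z where "z \<in> space P"
    using prob_space.not_empty[OF prob(1)] by blast
  then have "0 \<le> L"
    using f_smooth lipschitz_on_nonneg by blast
  then show ?thesis
    using speedup_tendsto[of D L \<sigma> k \<rho> b m_srl m_dmb \<delta>] params rho b_pos b_theta m_srl m_dmb by blast
qed

end
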